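(* Let $k\in\mathbb{N}$. Define the following subsets of $\mathbb{Z}_{\frac{3(2k+1)^2+1}{2}}\times\mathbb{Z}_2$, where the first component is taken modulo $\frac{3(2k+1)^2+1}{2}$ and the second component is taken modulo $2$: $$C_0=\bigcup_{i=0}^{2k}\{(-k+i,0)\},\qquad C_1=\bigcup_{i=0}^{2k}\{(k+1+(3k+2)i,\,i)\},\qquad C_2=\bigcup_{i=0}^{2k}\{(2k+1+(3k+1)i,\,i+1)\}.$$ Then $(C_0,C_1,C_2)$ forms a $(3(2k+1)^2+1,3,2k+1,1)$-CEDF in the non-cyclic abelian group $\mathbb{Z}_{\frac{3(2k+1)^2+1}{2}}\times\mathbb{Z}_2$ (direct product), and each $C_i$ ($0\le i\le 2$) is a symmetric set in this group.
   Context: For a group $K$ with multiplication $*$ and subsets $X,Y\subseteq K$: $\mathrm{Inv}(X;K)$ is the set of inverses in $K$ of the elements of $X$; $X$ is symmetric in $K$ if $X=\mathrm{Inv}(X;K)$; and $D(X,Y;K)$ is the multiset $\{x*y':x\in X,\ y'\in\mathrm{Inv}(Y;K)\}$. In an additively written abelian group, $D(X,Y;K)=\{x-y:x\in X,y\in Y\}$ and $X$ is symmetric if and only if $X=-X$. CEDF (circular external difference family): let $K$ be a group of order $v$ with identity $e$ and let $m>1$. An ordered collection $(C_0,\ldots,C_{m-1})$ of disjoint subsets of $K$, each of size $l$, is a $(v,m,l,\lambda)$-CEDF in $K$ if the multiset union $\bigcup_{i=0}^{m-1}D(C_{i+1 \bmod m},C_i;K)$ equals the multiset consisting of $\lambda$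 copies of $K\setminus\{e\}$. *)

theory Defs
  imports "HOL-Algebra.Elementary_Groups" "HOL-Library.Multiset"
begin

(* The multiset of all x * y' with x in X and y' in Inv(Y;K), for finite X and Y
   (mset_set is empty on infinite sets). *)
definition diff_mset :: "('a, 'b) monoid_scheme \<Rightarrow> 'a set \<Rightarrow> 'a set \<Rightarrow> 'a multiset" where
  "diff_mset K X Y = image_mset (\<lambda>(x, y'). x \<otimes>\<^bsub>K\<^esub> y') (mset_set (X \<times> set_inv\<^bsub>K\<^esub> Y))"

definition symmetric_in :: "('a, 'b) monoid_scheme \<Rightarrow> 'a set \<Rightarrow> bool" where
  "symmetric_in K X \<longleftrightarrow> X \<subseteq> carrier K \<and> X = set_inv\<^bsub>K\<^esub> X"

(* Finiteness of the carrier is explicit because order K is 0 when the carrier is infinite. *)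
definition is_CEDF ::
    "('a, 'b) monoid_scheme \<Rightarrow> nat \<Rightarrow> nat \<Rightarrow> nat \<Rightarrow> nat \<Rightarrow> 'a set list \<Rightarrow> bool" where
  "is_CEDF K v m l lam Cs \<longleftrightarrow>
     group K \<and> finite (carrier K) \<and> order K = v \<and> m > 1 \<and> length Cs = m \<and>
     (\<forall>i<m. Cs ! i \<subseteq> carrier K \<and> card (Cs ! i) = l) \<and>
     (\<forall>i<m. \<forall>j<m. i \<noteq> j \<longrightarrow> Cs ! i \<inter> Cs ! j = {}) \<and>
     (\<Sum>i<m. diff_mset K (Cs ! ((i + 1) mod m)) (Cs ! i))
       = repeat_mset lam (mset_set (carrier K - {\<one>\<^bsub>K\<^esub>}))"

(* 3 * (2k+1)^2 + 1 is always even, so the division is exact; the value is positive. *)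
definition modulus :: "nat \<Rightarrow> nat" where
  "modulus k = (3 * (2 * k + 1)\<^sup>2 + 1) div 2"

definition grp :: "nat \<Rightarrow> (int \<times> int) monoid" where
  "grp k = integer_mod_group (modulus k) \<times>\<times> integer_mod_group 2"

(* The element of grp k represented by a pair of integers; the carriers of the two factors
   are the canonical residues {0..<modulus k} and {0..<2}. *)
definition residue_pair :: "nat \<Rightarrow> int \<Rightarrow> int \<Rightarrow> int \<times> int" where
  "residue_pair k a b = (a mod int (modulus k), b mod 2)"

definition C0 :: "nat \<Rightarrow> (int \<times> int) set" where
  "C0 k = (\<Union>i\<in>{0..2 * k}. {residue_pair k (- int k + int i) 0})"

definition C1 :: "nat \<Rightarrow> (int \<times> int) set" where
  "C1 k = (\<Union>i\<in>{0..2 * k}.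
     {residue_pair k (int k + 1 + (3 * int k + 2) * int i) (int i)})"

definition C2 :: "nat \<Rightarrow> (int \<times> int) set" where
  "C2 k = (\<Union>i\<in>{0..2 * k}.
     {residue_pair k (2 * int k + 1 + (3 * int k + 1) * int i) (int i + 1)})"

end

theory Submission
  imports Defs
begin

text \<open>
  Write \<open>h = 3k\<^sup>2 + 3k + 1\<close>, so that the first component of the group lives modulo \<open>2h\<close>. Shifting
  the index by \<open>k\<close> shows what the three sets are: for \<open>a\<close>, \<open>b\<close>, \<open>c\<close> running over the integers of
  absolute value at most \<open>k\<close>, they consist of the elements
    \<open>(c, 0)\<close>, \<open>(h + (3k + 2) a, k + a)\<close> and \<open>(h + (3k + 1) b, k + b + 1)\<close>.
  As \<open>2h\<close> and \<open>2\<close> vanish in the two components, inversion maps the element with parameter \<open>a\<close>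
  to the one with parameter \<open>-a\<close> in each set, so each set is symmetric.

  The three families of differences comprise \<open>3 (2k + 1)\<^sup>2\<close> pairs, which is the number of nonidentity
  elements of the group. By counting (\<open>is_CEDF_if_differences_distinct\<close>) it is enough that all
  these differences are distinct from each other and from the identity. Each such claim asserts
  that a certain integer combination of small parameters is not divisible by \<open>2h\<close>. The combination
  is bounded by a small multiple of \<open>h\<close>, so a congruence would force one of very few equations
  over the integers. Dividing such an equation by \<open>3k + 1\<close> with remainder leaves at most
  two values for a combination such as \<open>b - a\<close>, and the range of the parameters together with the
  parity in the second component leaves only the trivial solution, or none. Distinct families are separated in this way by
  \<open>diff10_diff21_incongruent\<close>, \<open>diff10_diff02_incongruent\<close> and \<open>diff21_diff02_incongruent\<close>.

  The group is not cyclic because both moduli are even.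
\<close>

section \<open>External difference families by counting\<close>

text \<open>
  Pairing with the set of inverses of \<open>Y\<close> is the same as pairing with \<open>Y\<close> itself, as inversion is
  injective and hence merges no two second components.
\<close>

lemma diff_mset_eq:
  fixes K (structure)
  assumes "group K" "Y \<subseteq> carrier K"
  shows "diff_mset K X Y = image_mset (\<lambda>(x, y). x \<otimes> inv y) (mset_set (X \<times> Y))"
proof -
  interpret group K by fact
  have "inj_on (m_inv K) Y" using assms(2) by (meson inj_on_subset inv_inj)
  then have "inj_on (map_prod id (m_inv K)) (X \<times> Y)"
    by (intro map_prod_inj_on) auto
  moreover have "X \<times> set_inv Y = map_prod id (m_inv K) ` (X \<times> Y)"
    by (force simp: SET_INV_def)
  ultimately show ?thesis
    by (simp add: diff_mset_def image_mset_mset_set[symmetric] multiset.map_comp comp_def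
        case_prod_unfold)
qed

text \<open>
  Injectivity on the disjoint union \<open>Sigma I A\<close> says at once that \<open>f\<close> is injective on every \<open>A i\<close>
  and that the images for different indices are disjoint, so the multiset sum has no repetitions.
\<close>

lemma sum_image_mset_eq_mset_set:
  assumes "finite I" "\<And>i. i \<in> I \<Longrightarrow> finite (A i)" "inj_on (\<lambda>(i, p). f p) (Sigma I A)"
  shows "(\<Sum>i\<in>I. image_mset f (mset_set (A i))) = mset_set ((\<lambda>(i, p). f p) ` Sigma I A)"
  using assms
proof (induction I rule: finite_induct)
  case (insert j I)
  let ?g = "\<lambda>(i, p). f p"
  have split: "Sigma (insert j I) A = Pair j ` A j \<union> Sigma I A" by auto
  have inj: "inj_on ?g (Pair j ` A j \<union> Sigma I A)" using insert.prems by (simp add: split)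
  have "inj_on f (A j)"
    using insert.prems(2) by (auto simp: inj_on_def)
  moreover have "f ` A j \<inter> ?g ` Sigma I A = {}"
    using insert.prems(2) insert.hyps(2) by (fastforce simp: inj_on_def)
  moreover have "inj_on ?g (Sigma I A)" using inj by (simp add: inj_on_Un)
  moreover have "?g ` Sigma (insert j I) A = f ` A j \<union> ?g ` Sigma I A"
    by (simp add: split image_Un image_image)
  ultimately show ?case
    using insert by (simp add: image_mset_mset_set mset_set_Union)
qed simp

text \<open>
  The differences form a set of \<open>m l\<^sup>2\<close> nonidentity elements, and the group has exactly that many, so
  each nonidentity element is attained, exactly once. This removes all surjectivity arguments.
\<close>

lemma is_CEDF_if_differences_distinct:
  fixes K (structure)
  assumes "group K" and fin: "finite (carrier K)" and ord: "order K = m * l\<^sup>2 + 1"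
    and m: "m > 1" "length Cs = m"
    and sub: "\<And>i. i < m \<Longrightarrow> Cs ! i \<subseteq> carrier K" and card: "\<And>i. i < m \<Longrightarrow> card (Cs ! i) = l"
    and disj: "\<And>i j. i < m \<Longrightarrow> j < m \<Longrightarrow> i \<noteq> j \<Longrightarrow> Cs ! i \<inter> Cs ! j = {}"
    and inj: "inj_on (\<lambda>(i, x, y). x \<otimes> inv y) (SIGMA i:{..<m}. Cs ! ((i + 1) mod m) \<times> Cs ! i)"
    and one: "\<And>i x y. i < m \<Longrightarrow> x \<in> Cs ! ((i + 1) mod m) \<Longrightarrow> y \<in> Cs ! i \<Longrightarrow> x \<otimes> inv y \<noteq> \<one>"
  shows "is_CEDF K (order K) m l 1 Cs"
proof -
  interpret group K by fact
  let ?P = "\<lambda>i. Cs ! ((i + 1) mod m) \<times> Cs ! i"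
  let ?f = "\<lambda>(x, y). x \<otimes> inv y"
  let ?g = "\<lambda>(i, x, y). x \<otimes> inv y"
  have next_m: "(i + 1) mod m < m" for i using m by simp
  have finC: "finite (Cs ! i)" if "i < m" for i using sub[OF that] fin finite_subset by blast
  have finP: "finite (?P i)" if "i < m" for i using that finC next_m by blast
  have "card (?g ` (SIGMA i:{..<m}. ?P i)) = card (SIGMA i:{..<m}. ?P i)"
    using inj by (rule card_image)
  also have "\<dots> = (\<Sum>i<m. card (?P i))" using finP by simp
  also have "\<dots> = m * l\<^sup>2" using card next_m by (simp add: card_cartesian_product power2_eq_square)
  also have "\<dots> = card (carrier K - {\<one>})" using ord by (simp add: order_def card_Diff_singleton)
  finally have "card (?g ` (SIGMA i:{..<m}. ?P i)) = card (carrier K - {\<one>})" .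
  moreover have "?g ` (SIGMA i:{..<m}. ?P i) \<subseteq> carrier K - {\<one>}"
  proof -
    have "x \<otimes> inv y \<in> carrier K - {\<one>}"
      if "i < m" "x \<in> Cs ! ((i + 1) mod m)" "y \<in> Cs ! i" for i x y
      using one[OF that] subsetD[OF sub[OF next_m] that(2)] subsetD[OF sub[OF that(1)] that(3)] by simp
    then show ?thesis by auto
  qed
  ultimately have all: "?g ` (SIGMA i:{..<m}. ?P i) = carrier K - {\<one>}"
    using fin by (intro card_subset_eq) auto
  have "(\<Sum>i<m. diff_mset K (Cs ! ((i + 1) mod m)) (Cs ! i))
      = (\<Sum>i<m. image_mset ?f (mset_set (?P i)))"
    using sub by (intro sum.cong refl diff_mset_eq) (auto simp: is_group)
  also have "\<dots> = mset_set (?g ` (SIGMA i:{..<m}. ?P i))"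
    using inj by (intro sum_image_mset_eq_mset_set finP) auto
  also have "\<dots> = repeat_mset 1 (mset_set (carrier K - {\<one>}))" unfolding all by simp
  finally show ?thesis
    unfolding is_CEDF_def using m sub card disj fin is_group by blast
qed

section \<open>Non-cyclic products of cyclic groups\<close>

lemma int_pow_DirProd:
  assumes "group G" "group H" "x \<in> carrier G" "y \<in> carrier H"
  shows "(x, y) [^]\<^bsub>G \<times>\<times> H\<^esub> (n::int) = (x [^]\<^bsub>G\<^esub> n, y [^]\<^bsub>H\<^esub> n)"
proof -
  interpret P: group "G \<times>\<times> H" using assms by (intro DirProd_group)
  interpret f: group_hom "G \<times>\<times> H" G fst
    using assms(1,2) P.is_group by (auto simp: group_hom_def group_hom_axioms_def hom_def)
  interpret s: group_hom "G \<times>\<times> H" H snd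
    using assms(1,2) P.is_group by (auto simp: group_hom_def group_hom_axioms_def hom_def)
  show ?thesis
    using f.hom_int_pow[of "(x, y)" n] s.hom_int_pow[of "(x, y)" n] assms
    by (simp add: prod_eq_iff)
qed

text \<open>
  If \<open>(a, b)\<close> were a generator, then \<open>(1, 0)\<close> and \<open>(0, 1)\<close> would be its multiples by some \<open>s\<close> and
  \<open>t\<close>. Modulo the common divisor \<open>d\<close> of \<open>m\<close> and \<open>n\<close>, the product \<open>s a t b = s b t a\<close> is then both
  \<open>1\<close> and \<open>0\<close>.
\<close>

lemma not_cyclic_DirProd_integer_mod_group:
  assumes "\<not> coprime m n"
  shows "\<not> cyclic_group (integer_mod_group m \<times>\<times> integer_mod_group n)"
proof
  let ?G = "integer_mod_group m \<times>\<times> integer_mod_group n"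
  assume "cyclic_group ?G"
  moreover have "group ?G" by (intro DirProd_group) simp_all
  ultimately obtain a b where ab: "(a, b) \<in> carrier ?G"
    and gen: "carrier ?G = range (\<lambda>i::int. (a, b) [^]\<^bsub>?G\<^esub> i)"
    by (auto simp: group.cyclic_group)
  have pow: "(a, b) [^]\<^bsub>?G\<^esub> i = (i * a mod int m, i * b mod int n)" for i :: int
    using ab by (subst int_pow_DirProd) (auto simp: int_pow_integer_mod_group)
  have "m \<noteq> 1" "n \<noteq> 1" using assms by auto
  then have "(1, 0) \<in> carrier ?G" "(0, 1) \<in> carrier ?G" by auto
  then obtain s t where "(1, 0) = (a, b) [^]\<^bsub>?G\<^esub> (s::int)" "(0, 1) = (a, b) [^]\<^bsub>?G\<^esub> (t::int)"
    unfolding gen by (metis (no_types, lifting) rangeE)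
  then have st: "s * a mod int m = 1" "s * b mod int n = 0"
      "t * a mod int m = 0" "t * b mod int n = 1"
    by (simp_all add: pow)
  define d where "d = int (gcd m n)"
  have "d dvd int m" "d dvd int n" by (simp_all add: d_def)
  with st have "d dvd s * a - 1" "d dvd t * b - 1" "d dvd s * b"
    by (metis dvd_trans dvd_minus_mod minus_mod_self2 mod_0_imp_dvd)+
  moreover have "1 = s * b * (t * a) - (s * a - 1) * (t * b) - (t * b - 1)"
    by (simp add: algebra_simps)
  ultimately have "d dvd 1" by (metis dvd_diff dvd_mult2)
  then show False using assms by (simp add: d_def coprime_iff_gcd_eq_1)
qed

section \<open>Congruences between the differences\<close>

lemma dvd_small_int:
  fixes m x :: int
  assumes "m dvd x" "\<bar>x\<bar> < m"
  shows "x = 0"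
  using assms dvd_imp_le_int[of x m] by fastforce

text \<open>
  The form in which division with remainder is used: an integer strictly between \<open>-m\<close> and \<open>2m\<close> has
  only two possible quotients if it is a multiple of \<open>m\<close>.
\<close>

lemma factor_zero_or_one:
  fixes m y r :: int
  assumes "m * y = r" "- m < r" "r < 2 * m"
  shows "y = 0 \<or> y = 1"
proof -
  have "m > 0" using assms by linarith
  have "m * (-1) < m * y" using assms by simp
  moreover have "m * y < m * 2" using assms by (simp only: mult.commute[of m 2])
  ultimately have "-1 < y" "y < 2" using mult_less_cancel_left_pos[OF \<open>m > 0\<close>] by blast+
  then show ?thesis by linarith
qed

lemma mult_bounds:
  fixes s x B :: int
  assumes "0 \<le> s" "\<bar>x\<bar> \<le> B"
  shows "s * x \<le> s * B" "- (s * B) \<le> s * x"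
proof -
  have "\<bar>s * x\<bar> \<le> s * B" using assms by (simp add: abs_mult mult_left_mono)
  then show "s * x \<le> s * B" "- (s * B) \<le> s * x" by linarith+
qed

text \<open>
  The modulus of the first component is \<open>2 * h\<close>. The lemmas below are about integers only:
  divisibility by \<open>2 * h\<close> stands for equality in the first component, and the parity hypotheses
  stand for equality in the second.
\<close>

context
  fixes k h :: int
  assumes k: "0 \<le> k" and h: "h = 3 * k * k + 3 * k + 1"
begin

text \<open>
  The integer \<open>s (a - a') - (c - c')\<close> has absolute value at most \<open>2k (s + 1) \<le> 6k\<^sup>2 + 6k < 2h\<close>, so
  it vanishes. Then \<open>s\<close> divides \<open>c - c'\<close>, whose absolute value is at most \<open>2k < s\<close>. This covers
  the differences of \<open>C0\<close> with either of the other two sets, and with \<open>c = c'\<close> or \<open>a = a'\<close> also the fact that each set has \<open>2k + 1\<close> elements.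
\<close>

lemma progression_differences_distinct:
  assumes s: "s = 3 * k + 1 \<or> s = 3 * k + 2"
    and "\<bar>a\<bar> \<le> k" "\<bar>a'\<bar> \<le> k" "\<bar>c\<bar> \<le> k" "\<bar>c'\<bar> \<le> k"
    and dvd: "2 * h dvd s * (a - a') - (c - c')"
  shows "a = a' \<and> c = c'"
proof -
  have "\<bar>a - a'\<bar> \<le> 2 * k" "\<bar>c - c'\<bar> \<le> 2 * k" using assms by linarith+
  moreover have "0 \<le> s" using s k by auto
  ultimately have "\<bar>s * (a - a') - (c - c')\<bar> \<le> s * (2 * k) + 2 * k"
    using mult_bounds[of s "a - a'" "2 * k"] by linarith
  also have "\<dots> < 2 * h" using s k by (auto simp: h algebra_simps)
  finally have "s * (a - a') - (c - c') = 0" using dvd dvd_small_int by blast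
  then have eq: "s * (a - a') = c - c'" by simp
  then have "s dvd c - c'" by (metis dvd_triv_left)
  moreover have "\<bar>c - c'\<bar> < s" using s \<open>\<bar>c - c'\<bar> \<le> 2 * k\<close> k by auto
  ultimately have "c - c' = 0" by (rule dvd_small_int)
  moreover have "s \<noteq> 0" using s k by linarith
  ultimately have "a - a' = 0" "c - c' = 0" using eq by auto
  then show ?thesis by simp
qed

text \<open>
  Put \<open>A = a - a'\<close> and \<open>B = b - b'\<close>. Here \<open>(3k + 1) B - (3k + 2) A\<close> is only bounded by
  \<open>12k\<^sup>2 + 6k < 4h\<close>, so besides \<open>0\<close> the values \<open>2h\<close> and \<open>-2h\<close> have to be excluded; changing the signs
  of \<open>A\<close> and \<open>B\<close> reduces the second to the first. The value \<open>2h\<close> leaves \<open>2k + 1\<close> and \<open>2k + 2\<close> for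
  \<open>B - A\<close>. The former is odd, and the latter gives \<open>A = 2k\<close> and \<open>B = 4k + 2\<close>, which is too large.
\<close>

lemma mixed_differences_distinct:
  assumes "\<bar>a\<bar> \<le> k" "\<bar>a'\<bar> \<le> k" "\<bar>b\<bar> \<le> k" "\<bar>b'\<bar> \<le> k"
    and dvd: "2 * h dvd (3 * k + 1) * (b - b') - (3 * k + 2) * (a - a')"
    and par: "even ((b - b') - (a - a'))"
  shows "b = b' \<and> a = a'"
proof -
  define F where "F B A = (3 * k + 1) * B - (3 * k + 2) * A" for B A
  have not_modulus: "F B A \<noteq> 2 * h"
    if A: "\<bar>A\<bar> \<le> 2 * k" and B: "\<bar>B\<bar> \<le> 2 * k" and AB: "even (B - A)" for A B
  proof
    assume "F B A = 2 * h"
    \<comment> \<open>Here \<open>2 * h = (3 * k + 1) * (2 * k + 1) + k + 1\<close>.\<close>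
    then have "(3 * k + 1) * (B - A - 2 * k - 1) = A + k + 1"
      by (simp add: F_def h algebra_simps)
    moreover define y where "y = B - A - 2 * k - 1"
    ultimately have eq: "(3 * k + 1) * y = A + k + 1" by simp
    then have "y = 0 \<or> y = 1" by (rule factor_zero_or_one) (use A k in auto)
    moreover have "odd y" using AB by (simp add: y_def)
    ultimately have y: "y = 1" by auto
    then have "3 * k + 1 = A + k + 1" using eq by simp
    moreover have "B - A = 2 * k + 2" using y y_def by linarith
    ultimately show False using A B k by linarith
  qed
  define A B where "A = a - a'" and "B = b - b'"
  have A: "\<bar>A\<bar> \<le> 2 * k" and B: "\<bar>B\<bar> \<le> 2 * k" using assms by (auto simp: A_def B_def)
  have "\<bar>F B A\<bar> \<le> (3 * k + 1) * (2 * k) + (3 * k + 2) * (2 * k)"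
    unfolding F_def using mult_bounds[OF _ B, of "3 * k + 1"] mult_bounds[OF _ A, of "3 * k + 2"] k
    by linarith
  also have "\<dots> < 2 * (2 * h)" using k by (simp add: h algebra_simps)
  finally have bound: "\<bar>F B A\<bar> < 2 * (2 * h)" .
  obtain q where q: "F B A = 2 * h * q" using dvd by (auto simp: F_def A_def B_def)
  have hpos: "h > 0" using k by (simp add: h add_nonneg_pos)
  have "2 * h * \<bar>q\<bar> < 2 * h * 2" using bound q hpos by (simp add: abs_mult)
  then have "\<bar>q\<bar> < 2" using hpos by simp
  moreover have "q \<noteq> 1" using not_modulus[OF A B] par q by (auto simp: A_def B_def)
  moreover have "q \<noteq> -1"
  proof
    assume "q = -1"
    then have "F (-B) (-A) = 2 * h" using q by (simp add: F_def algebra_simps)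
    moreover have "even (- B - - A)" using par unfolding A_def B_def by presburger
    ultimately show False using not_modulus[of "-A" "-B"] A B by simp
  qed
  ultimately have "q = 0" by linarith
  then have eq: "(3 * k + 1) * (B - A) = A" using q by (simp add: F_def algebra_simps)
  then have "3 * k + 1 dvd A" by (metis dvd_triv_left)
  then have "A = 0" by (rule dvd_small_int) (use A k in linarith)
  moreover from this eq k have "B = 0" by auto
  ultimately show ?thesis by (simp add: A_def B_def)
qed

text \<open>
  The odd multiples of \<open>h\<close> nearest to zero are the only integers of this size congruent to \<open>h\<close>. A
  shift by \<open>h\<close> survives when \<open>C2 - C1\<close>, which has none, is compared with \<open>C1 - C0\<close> or \<open>C0 - C2\<close>,
  which have one each.
\<close>

lemma congruent_to_half_modulus:
  assumes "2 * h dvd x - h" "\<bar>x\<bar> < 3 * h"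
  shows "x = h \<or> x = - h"
proof -
  obtain q where q: "x - h = 2 * h * q" using assms by auto
  then have "2 * h * (q + 1) = x + h" by (simp add: algebra_simps)
  then have "q + 1 = 0 \<or> q + 1 = 1"
    by (rule factor_zero_or_one) (use assms(2) in auto)
  then have "q = -1 \<or> q = 0" by linarith
  then show ?thesis using q by auto
qed

text \<open>
  The summand \<open>h\<close> dominates: \<open>s a - c\<close> has absolute value at most \<open>3k\<^sup>2 + 3k < h\<close>.
\<close>

lemma progression_difference_nonzero:
  assumes s: "s = 3 * k + 1 \<or> s = 3 * k + 2" and "\<bar>a\<bar> \<le> k" "\<bar>c\<bar> \<le> k"
  shows "\<not> 2 * h dvd h + s * a - c"
proof
  assume dvd: "2 * h dvd h + s * a - c"
  have "0 \<le> s" using s k by auto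
  then have "\<bar>s * a - c\<bar> \<le> s * k + k" using assms mult_bounds[of s a k] by linarith
  also have "\<dots> < h" using s k by (auto simp: h algebra_simps)
  finally have b: "\<bar>s * a - c\<bar> < h" .
  then have "h + s * a - c = 0" by (intro dvd_small_int[OF dvd]) linarith
  then show False using b by linarith
qed

text \<open>
  The bound \<open>6k\<^sup>2 + 3k < 2h\<close> forces \<open>(3k + 1) (b - a) = a\<close>, hence \<open>a = b = 0\<close>, against the parity.
\<close>

lemma mixed_difference_nonzero:
  assumes "\<bar>a\<bar> \<le> k" "\<bar>b\<bar> \<le> k" and par: "odd (b - a)"
  shows "\<not> 2 * h dvd (3 * k + 1) * b - (3 * k + 2) * a"
proof
  assume dvd: "2 * h dvd (3 * k + 1) * b - (3 * k + 2) * a"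
  have "\<bar>(3 * k + 1) * b - (3 * k + 2) * a\<bar> \<le> (3 * k + 1) * k + (3 * k + 2) * k"
    using mult_bounds[of "3 * k + 1" b k] mult_bounds[of "3 * k + 2" a k] assms k by linarith
  also have "\<dots> < 2 * h" using k by (simp add: h algebra_simps)
  finally have "(3 * k + 1) * b - (3 * k + 2) * a = 0" using dvd dvd_small_int by blast
  then have eq: "(3 * k + 1) * (b - a) = a" by (simp add: algebra_simps)
  then have "3 * k + 1 dvd a" by (metis dvd_triv_left)
  then have "a = 0" by (rule dvd_small_int) (use assms k in linarith)
  then have "b - a = 0" using eq k by auto
  then show False using par by simp
qed

text \<open>
  A coincidence between \<open>C1 - C0\<close> and \<open>C2 - C1\<close>. With \<open>S = a + a'\<close> it says that
  \<open>(3k + 1) b - (3k + 2) S + c\<close> is congruent to \<open>h\<close>, so it equals \<open>h\<close> or \<open>-h\<close>, and a change of all signs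
  makes it \<open>h\<close>. Division by \<open>3k + 1\<close> leaves \<open>k\<close> and \<open>k + 1\<close> for \<open>b - S\<close>. Parity excludes \<open>k\<close>, and
  \<open>b - S = k + 1\<close> gives \<open>S = c + k \<ge> 0\<close>, so that \<open>b > k\<close>.
\<close>

lemma diff10_diff21_incongruent:
  assumes a: "\<bar>a\<bar> \<le> k" and c: "\<bar>c\<bar> \<le> k" and a': "\<bar>a'\<bar> \<le> k" and b: "\<bar>b\<bar> \<le> k"
    and par: "even (k + a - (b - a' + 1))"
  shows "\<not> 2 * h dvd (h + (3 * k + 2) * a - c) - ((3 * k + 1) * b - (3 * k + 2) * a')"
proof
  define F where "F S b c = (3 * k + 1) * b - (3 * k + 2) * S + c" for S b c
  assume "2 * h dvd (h + (3 * k + 2) * a - c) - ((3 * k + 1) * b - (3 * k + 2) * a')"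
  then have dvd: "2 * h dvd F (a + a') b c - h"
    by (subst dvd_minus_iff[symmetric]) (simp add: F_def algebra_simps)
  have S: "\<bar>a + a'\<bar> \<le> 2 * k" using a a' by linarith
  have "\<bar>F (a + a') b c\<bar> \<le> (3 * k + 1) * k + (3 * k + 2) * (2 * k) + k"
    unfolding F_def
    using mult_bounds[OF _ b, of "3 * k + 1"] mult_bounds[OF _ S, of "3 * k + 2"] c k by linarith
  also have "\<dots> < 3 * h" using k by (simp add: h algebra_simps)
  finally have half: "F (a + a') b c = h \<or> F (a + a') b c = - h" using dvd congruent_to_half_modulus by blast
  have not_half: "F S b c \<noteq> h"
    if S: "\<bar>S\<bar> \<le> 2 * k" and b: "\<bar>b\<bar> \<le> k" and c: "\<bar>c\<bar> \<le> k" and par: "odd (b - S - k)" for S b c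
  proof
    assume "F S b c = h"
    \<comment> \<open>Here \<open>h = (3 * k + 1) * k + 2 * k + 1\<close>.\<close>
    then have "(3 * k + 1) * (b - S - k) = S - c + 2 * k + 1"
      by (simp add: F_def h algebra_simps)
    moreover define y where "y = b - S - k"
    ultimately have eq: "(3 * k + 1) * y = S - c + 2 * k + 1" by simp
    then have "y = 0 \<or> y = 1" by (rule factor_zero_or_one) (use S c k in auto)
    moreover have "odd y" using par by (simp add: y_def)
    ultimately have y: "y = 1" by auto
    then have "3 * k + 1 = S - c + 2 * k + 1" using eq by simp
    moreover have "b - S = k + 1" using y y_def by linarith
    ultimately show False using S b c k by linarith
  qed
  have "F (a + a') b c \<noteq> h"
    using S b c par by (intro not_half) presburger+
  moreover have "F (- (a + a')) (- b) (- c) \<noteq> h"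
    using S b c par by (intro not_half) presburger+
  moreover have "F (- (a + a')) (- b) (- c) = - F (a + a') b c" by (simp add: F_def algebra_simps)
  ultimately show False using half by auto
qed

text \<open>
  A coincidence between \<open>C1 - C0\<close> and \<open>C0 - C2\<close>. The two shifts by \<open>h\<close> add up to the modulus and
  disappear; what remains is smaller than \<open>2h\<close> and therefore zero, which forces \<open>a + b = 0\<close>.
  The second components require \<open>a + b\<close> to be odd.
\<close>

lemma diff10_diff02_incongruent:
  assumes a: "\<bar>a\<bar> \<le> k" and c: "\<bar>c\<bar> \<le> k" and b: "\<bar>b\<bar> \<le> k" and c': "\<bar>c'\<bar> \<le> k"
    and par: "even (k + a - (0 - (k + b + 1)))"
  shows "\<not> 2 * h dvd (h + (3 * k + 2) * a - c) - (c' - (h + (3 * k + 1) * b))"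
proof
  define E where "E = (3 * k + 2) * a + (3 * k + 1) * b - (c + c')"
  assume "2 * h dvd (h + (3 * k + 2) * a - c) - (c' - (h + (3 * k + 1) * b))"
  also have "\<dots> = E + 2 * h" by (simp add: E_def algebra_simps)
  finally have dvd: "2 * h dvd E" by simp
  have "\<bar>E\<bar> \<le> (3 * k + 2) * k + (3 * k + 1) * k + 2 * k"
    unfolding E_def
    using mult_bounds[OF _ b, of "3 * k + 1"] mult_bounds[OF _ a, of "3 * k + 2"] c c' k by linarith
  also have "\<dots> < 2 * h" using k by (simp add: h algebra_simps)
  finally have "E = 0" using dvd dvd_small_int by blast
  then have eq: "(3 * k + 1) * (a + b) = c + c' - a" by (simp add: E_def algebra_simps)
  then have "3 * k + 1 dvd c + c' - a" by (metis dvd_triv_left)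
  then have "c + c' - a = 0" by (rule dvd_small_int) (use a c c' k in linarith)
  then have "a + b = 0" using eq k by auto
  then show False using par by presburger
qed

text \<open>
  A coincidence between \<open>C2 - C1\<close> and \<open>C0 - C2\<close>. With \<open>T = b + b'\<close> it says, up to a change of all
  signs, that \<open>(3k + 1) T - (3k + 2) a - c = h\<close>. Then \<open>(3k + 1) (T - a - k) = a + c + 2k + 1\<close> lies
  strictly between \<open>0\<close> and \<open>2 (3k + 1)\<close>, so \<open>T - a - k = 1\<close>, whereas parity requires an even number.
\<close>

lemma diff21_diff02_incongruent:
  assumes a: "\<bar>a\<bar> \<le> k" and b: "\<bar>b\<bar> \<le> k" and b': "\<bar>b'\<bar> \<le> k" and c: "\<bar>c\<bar> \<le> k"
    and par: "even ((b - a + 1) - (0 - (k + b' + 1)))"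
  shows "\<not> 2 * h dvd ((3 * k + 1) * b - (3 * k + 2) * a) - (c - (h + (3 * k + 1) * b'))"
proof
  define F where "F T a c = (3 * k + 1) * T - (3 * k + 2) * a - c" for T a c
  assume "2 * h dvd ((3 * k + 1) * b - (3 * k + 2) * a) - (c - (h + (3 * k + 1) * b'))"
  also have "\<dots> = (F (b + b') a c - h) + 2 * h" by (simp add: F_def algebra_simps)
  finally have dvd: "2 * h dvd F (b + b') a c - h" by (simp only: dvd_add_triv_right_iff)
  have T: "\<bar>b + b'\<bar> \<le> 2 * k" using b b' by linarith
  have "\<bar>F (b + b') a c\<bar> \<le> (3 * k + 1) * (2 * k) + (3 * k + 2) * k + k"
    unfolding F_def
    using mult_bounds[OF _ T, of "3 * k + 1"] mult_bounds[OF _ a, of "3 * k + 2"] c k by linarith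
  also have "\<dots> < 3 * h" using k by (simp add: h algebra_simps)
  finally have half: "F (b + b') a c = h \<or> F (b + b') a c = - h" using dvd congruent_to_half_modulus by blast
  have not_half: "F T a c \<noteq> h"
    if T: "\<bar>T\<bar> \<le> 2 * k" and a: "\<bar>a\<bar> \<le> k" and c: "\<bar>c\<bar> \<le> k" and par: "even (T - a - k)" for T a c
  proof
    assume "F T a c = h"
    then have "(3 * k + 1) * (T - a - k) = a + c + 2 * k + 1"
      by (simp add: F_def h algebra_simps)
    moreover define y where "y = T - a - k"
    ultimately have eq: "(3 * k + 1) * y = a + c + 2 * k + 1" by simp
    then have "y = 0 \<or> y = 1" by (rule factor_zero_or_one) (use a c k in auto)
    moreover have "even y" using par by (simp add: y_def)
    ultimately have "y = 0" by presburger
    then show False using eq a c k by simp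
  qed
  have "F (b + b') a c \<noteq> h"
    using T a c par by (intro not_half) presburger+
  moreover have "F (- (b + b')) (- a) (- c) \<noteq> h"
    using T a c par by (intro not_half) presburger+
  moreover have "F (- (b + b')) (- a) (- c) = - F (b + b') a c" by (simp add: F_def algebra_simps)
  ultimately show False using half by auto
qed

end

section \<open>The ambient group\<close>

text \<open>Half of the modulus of the first component.\<close>

definition half :: "nat \<Rightarrow> int" where
  "half k = 3 * int k * int k + 3 * int k + 1"

lemma modulus_eq: "int (modulus k) = 2 * half k"
proof -
  have "3 * (2 * k + 1)\<^sup>2 + 1 = 2 * (2 * (3 * k * k + 3 * k + 1))"
    by (simp add: power2_eq_square algebra_simps)
  then show ?thesis by (simp add: modulus_def half_def)
qed

lemma half_pos: "half k > 0"
  by (simp add: half_def add_nonneg_pos)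

lemma carrier_grp: "carrier (grp k) = {0..<int (modulus k)} \<times> {0..<2}"
  using modulus_eq[of k] half_pos[of k] by (auto simp: grp_def carrier_integer_mod_group)

lemma group_grp: "group (grp k)"
  unfolding grp_def by (intro DirProd_group) simp_all

lemma comm_group_grp: "comm_group (grp k)"
  by (rule group.group_comm_groupI[OF group_grp]) (auto simp: grp_def add.commute)

lemma order_grp: "order (grp k) = 3 * (2 * k + 1)\<^sup>2 + 1"
proof -
  have "int (order (grp k)) = 2 * int (modulus k)"
    by (simp add: order_def carrier_grp card_cartesian_product)
  also have "\<dots> = int (3 * (2 * k + 1)\<^sup>2 + 1)"
    by (simp add: modulus_eq half_def power2_eq_square algebra_simps)
  finally show ?thesis by linarith
qed

lemma not_cyclic_grp: "\<not> cyclic_group (grp k)"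
proof -
  have "even (int (modulus k))" by (simp add: modulus_eq)
  then show ?thesis
    unfolding grp_def by (intro not_cyclic_DirProd_integer_mod_group) (simp add: coprime_commute)
qed

lemma residue_pair_in_carrier: "residue_pair k a b \<in> carrier (grp k)"
  using modulus_eq[of k] half_pos[of k] by (simp add: residue_pair_def carrier_grp)

text \<open>
  With this lemma and the three that follow it, computations in the group become computations with
  arbitrary integer representatives.
\<close>

lemma residue_pair_eq_iff:
  "residue_pair k a b = residue_pair k c d \<longleftrightarrow> 2 * half k dvd a - c \<and> even (b - d)"
  by (simp add: residue_pair_def modulus_eq mod_eq_dvd_iff)

lemma one_grp: "\<one>\<^bsub>grp k\<^esub> = residue_pair k 0 0"
  by (simp add: grp_def residue_pair_def)

lemma mult_residue_pair:
  "residue_pair k a b \<otimes>\<^bsub>grp k\<^esub> residue_pair k c d = residue_pair k (a + c) (b + d)"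
  by (simp add: grp_def residue_pair_def mod_add_eq)

lemma inv_residue_pair: "inv\<^bsub>grp k\<^esub> residue_pair k a b = residue_pair k (- a) (- b)"
  by (rule group.inv_equality[OF group_grp])
    (simp_all add: mult_residue_pair residue_pair_in_carrier one_grp)

section \<open>The three sets in centred form\<close>

lemma UN_singleton_centred:
  fixes k :: nat and f :: "int \<Rightarrow> 'a"
  shows "(\<Union>i\<in>{0..2 * k}. {f (int i)}) = (\<lambda>a. f (a + int k)) ` {- int k..int k}"
proof safe
  fix i assume "i \<in> {0..2 * k}"
  then show "f (int i) \<in> (\<lambda>a. f (a + int k)) ` {- int k..int k}"
    by (intro image_eqI[of _ _ "int i - int k"]) auto
next
  fix a assume "a \<in> {- int k..int k}"
  then show "f (a + int k) \<in> (\<Union>i\<in>{0..2 * k}. {f (int i)})"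
    by (intro UN_I[of "nat (a + int k)"]) auto
qed

text \<open>
  Parametrisations of the three sets by the integers of absolute value at most \<open>k\<close>, chosen such that
  the parameter \<open>0\<close> sits at the centre of symmetry.
\<close>

definition elt0 :: "nat \<Rightarrow> int \<Rightarrow> int \<times> int" where
  "elt0 k c = residue_pair k c 0"

definition elt1 :: "nat \<Rightarrow> int \<Rightarrow> int \<times> int" where
  "elt1 k a = residue_pair k (half k + (3 * int k + 2) * a) (int k + a)"

definition elt2 :: "nat \<Rightarrow> int \<Rightarrow> int \<times> int" where
  "elt2 k b = residue_pair k (half k + (3 * int k + 1) * b) (int k + b + 1)"

lemma C0_centred: "C0 k = elt0 k ` {- int k..int k}"
  unfolding C0_def elt0_def
  by (subst UN_singleton_centred[where f = "\<lambda>i. residue_pair k (- int k + i) 0"]) simp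

lemma C1_centred: "C1 k = elt1 k ` {- int k..int k}"
  unfolding C1_def elt1_def
  by (subst UN_singleton_centred
      [where f = "\<lambda>i. residue_pair k (int k + 1 + (3 * int k + 2) * i) i"])
    (simp add: half_def algebra_simps)

lemma C2_centred: "C2 k = elt2 k ` {- int k..int k}"
  unfolding C2_def elt2_def
  by (subst UN_singleton_centred
      [where f = "\<lambda>i. residue_pair k (2 * int k + 1 + (3 * int k + 1) * i) (i + 1)"])
    (simp add: half_def algebra_simps)

text \<open>
  A parametrisation that turns negation into inversion maps the symmetric interval to a symmetric
  set.
\<close>

lemma symmetric_in_odd_image:
  assumes "\<And>a. p a \<in> carrier K" "\<And>a. inv\<^bsub>K\<^esub> p a = p (- a)"
  shows "symmetric_in K (p ` {- m..m::int})"
proof -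
  have "p ` {- m..m} = p ` uminus ` {- m..m}" by simp
  also have "\<dots> = set_inv\<^bsub>K\<^esub> (p ` {- m..m})"
    unfolding image_image assms(2)[symmetric] by (auto simp: SET_INV_def)
  finally show ?thesis using assms(1) by (auto simp: symmetric_in_def)
qed

lemma symmetric_C0: "symmetric_in (grp k) (C0 k)"
  unfolding C0_centred
  by (rule symmetric_in_odd_image) (simp_all add: elt0_def residue_pair_in_carrier inv_residue_pair)

lemma symmetric_C1: "symmetric_in (grp k) (C1 k)"
  unfolding C1_centred
  by (rule symmetric_in_odd_image)
    (simp_all add: elt1_def residue_pair_in_carrier inv_residue_pair residue_pair_eq_iff)

lemma symmetric_C2: "symmetric_in (grp k) (C2 k)"
  unfolding C2_centred
  by (rule symmetric_in_odd_image)
    (simp_all add: elt2_def residue_pair_in_carrier inv_residue_pair residue_pair_eq_iff)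

lemma inj_elt0: "inj_on (elt0 k) {- int k..int k}"
proof (rule inj_onI)
  fix a a' assume "a \<in> {- int k..int k}" "a' \<in> {- int k..int k}" and eq: "elt0 k a = elt0 k a'"
  moreover have "2 * half k dvd (3 * int k + 1) * (0 - 0) - (a - a')"
    using eq by (simp add: elt0_def residue_pair_eq_iff dvd_diff_commute)
  ultimately show "a = a'"
    using progression_differences_distinct[OF of_nat_0_le_iff[of k] half_def[of k], of "3 * int k + 1" 0 0 a a']
    by (simp add: abs_le_iff)
qed

lemma inj_elt1: "inj_on (elt1 k) {- int k..int k}"
proof (rule inj_onI)
  fix a a' assume "a \<in> {- int k..int k}" "a' \<in> {- int k..int k}" and eq: "elt1 k a = elt1 k a'"
  moreover have "2 * half k dvd (3 * int k + 2) * (a - a') - (0 - 0)"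
    using eq by (simp add: elt1_def residue_pair_eq_iff right_diff_distrib)
  ultimately show "a = a'"
    using progression_differences_distinct[OF of_nat_0_le_iff[of k] half_def[of k], of "3 * int k + 2" a a' 0 0]
    by (simp add: abs_le_iff)
qed

lemma inj_elt2: "inj_on (elt2 k) {- int k..int k}"
proof (rule inj_onI)
  fix a a' assume "a \<in> {- int k..int k}" "a' \<in> {- int k..int k}" and eq: "elt2 k a = elt2 k a'"
  moreover have "2 * half k dvd (3 * int k + 1) * (a - a') - (0 - 0)"
    using eq by (simp add: elt2_def residue_pair_eq_iff right_diff_distrib)
  ultimately show "a = a'"
    using progression_differences_distinct[OF of_nat_0_le_iff[of k] half_def[of k], of "3 * int k + 1" a a' 0 0]
    by (simp add: abs_le_iff)
qed

section \<open>The differences\<close>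

text \<open>
  \<open>diff10\<close>, \<open>diff21\<close> and \<open>diff02\<close> are the differences \<open>C1 - C0\<close>, \<open>C2 - C1\<close> and \<open>C0 - C2\<close> in terms of the
  parameters. The representatives are left in the shape in which the congruence lemmas expect them.
\<close>

definition diff10 :: "nat \<Rightarrow> int \<Rightarrow> int \<Rightarrow> int \<times> int" where
  "diff10 k a c = residue_pair k (half k + (3 * int k + 2) * a - c) (int k + a)"

definition diff21 :: "nat \<Rightarrow> int \<Rightarrow> int \<Rightarrow> int \<times> int" where
  "diff21 k b a = residue_pair k ((3 * int k + 1) * b - (3 * int k + 2) * a) (b - a + 1)"

definition diff02 :: "nat \<Rightarrow> int \<Rightarrow> int \<Rightarrow> int \<times> int" where
  "diff02 k c b = residue_pair k (c - (half k + (3 * int k + 1) * b)) (0 - (int k + b + 1))"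

lemma elt_differences:
  "elt1 k a \<otimes>\<^bsub>grp k\<^esub> inv\<^bsub>grp k\<^esub> elt0 k c = diff10 k a c"
  "elt2 k b \<otimes>\<^bsub>grp k\<^esub> inv\<^bsub>grp k\<^esub> elt1 k a = diff21 k b a"
  "elt0 k c \<otimes>\<^bsub>grp k\<^esub> inv\<^bsub>grp k\<^esub> elt2 k b = diff02 k c b"
  by (simp_all add: elt0_def elt1_def elt2_def diff10_def diff21_def diff02_def inv_residue_pair mult_residue_pair
      algebra_simps)

context
  fixes k :: nat and I :: "int set"
  defines "I \<equiv> {- int k..int k}"
begin

lemma I_iff: "a \<in> I \<longleftrightarrow> \<bar>a\<bar> \<le> int k"
  by (auto simp: I_def abs_le_iff)

lemmas arith_context = of_nat_0_le_iff[of k] half_def[of k]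

lemma diff10_eq_iff:
  assumes "a \<in> I" "a' \<in> I" "c \<in> I" "c' \<in> I"
  shows "diff10 k a c = diff10 k a' c' \<longleftrightarrow> a = a' \<and> c = c'"
proof
  assume "diff10 k a c = diff10 k a' c'"
  then have "2 * half k dvd (half k + (3 * int k + 2) * a - c) - (half k + (3 * int k + 2) * a' - c')"
    by (simp only: diff10_def residue_pair_eq_iff)
  also have "\<dots> = (3 * int k + 2) * (a - a') - (c - c')" by (simp add: algebra_simps)
  finally show "a = a' \<and> c = c'"
    using progression_differences_distinct[OF arith_context, of "3 * int k + 2" a a' c c'] assms
    by (simp only: I_iff) simp
qed simp

lemma diff21_eq_iff:
  assumes "a \<in> I" "a' \<in> I" "b \<in> I" "b' \<in> I"
  shows "diff21 k b a = diff21 k b' a' \<longleftrightarrow> b = b' \<and> a = a'"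
proof
  assume "diff21 k b a = diff21 k b' a'"
  then have dvd: "2 * half k dvd ((3 * int k + 1) * b - (3 * int k + 2) * a)
        - ((3 * int k + 1) * b' - (3 * int k + 2) * a')"
    and par: "even ((b - a + 1) - (b' - a' + 1))"
    unfolding diff21_def residue_pair_eq_iff by blast+
  from par have "even ((b - b') - (a - a'))" by presburger
  moreover have "2 * half k dvd (3 * int k + 1) * (b - b') - (3 * int k + 2) * (a - a')"
    using dvd by (simp only: right_diff_distrib) (simp only: algebra_simps)
  ultimately show "b = b' \<and> a = a'"
    using mixed_differences_distinct[OF arith_context, of a a' b b'] assms
    by (simp only: I_iff)
qed simp

lemma diff02_eq_iff:
  assumes "b \<in> I" "b' \<in> I" "c \<in> I" "c' \<in> I"
  shows "diff02 k c b = diff02 k c' b' \<longleftrightarrow> c = c' \<and> b = b'"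
proof
  assume "diff02 k c b = diff02 k c' b'"
  then have "2 * half k dvd (c - (half k + (3 * int k + 1) * b)) - (c' - (half k + (3 * int k + 1) * b'))"
    by (simp add: diff02_def residue_pair_eq_iff)
  also have "\<dots> = - ((3 * int k + 1) * (b - b') - (c - c'))" by (simp add: algebra_simps)
  finally show "c = c' \<and> b = b'"
    using progression_differences_distinct[OF arith_context, of "3 * int k + 1" b b' c c'] assms
    by (simp only: dvd_minus_iff I_iff) simp
qed simp

lemma diff10_ne_diff21: "a \<in> I \<Longrightarrow> c \<in> I \<Longrightarrow> b \<in> I \<Longrightarrow> a' \<in> I \<Longrightarrow> diff10 k a c \<noteq> diff21 k b a'"
  unfolding I_iff diff10_def diff21_def residue_pair_eq_iff
  using diff10_diff21_incongruent[OF arith_context] by blast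

lemma diff10_ne_diff02: "a \<in> I \<Longrightarrow> c \<in> I \<Longrightarrow> b \<in> I \<Longrightarrow> c' \<in> I \<Longrightarrow> diff10 k a c \<noteq> diff02 k c' b"
  unfolding I_iff diff10_def diff02_def residue_pair_eq_iff
  using diff10_diff02_incongruent[OF arith_context] by blast

lemma diff21_ne_diff02: "a \<in> I \<Longrightarrow> b \<in> I \<Longrightarrow> b' \<in> I \<Longrightarrow> c \<in> I \<Longrightarrow> diff21 k b a \<noteq> diff02 k c b'"
  unfolding I_iff diff21_def diff02_def residue_pair_eq_iff
  using diff21_diff02_incongruent[OF arith_context] by blast

lemma diff10_ne_one: "a \<in> I \<Longrightarrow> c \<in> I \<Longrightarrow> diff10 k a c \<noteq> \<one>\<^bsub>grp k\<^esub>"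
  using progression_difference_nonzero[OF arith_context, of "3 * int k + 2" a c]
  by (simp add: I_iff diff10_def one_grp residue_pair_eq_iff)

lemma diff21_ne_one: "a \<in> I \<Longrightarrow> b \<in> I \<Longrightarrow> diff21 k b a \<noteq> \<one>\<^bsub>grp k\<^esub>"
  using mixed_difference_nonzero[OF arith_context, of a b]
  unfolding I_iff diff21_def one_grp residue_pair_eq_iff by auto

lemma diff02_ne_one: "b \<in> I \<Longrightarrow> c \<in> I \<Longrightarrow> diff02 k c b \<noteq> \<one>\<^bsub>grp k\<^esub>"
  using progression_difference_nonzero[OF arith_context, of "3 * int k + 1" b c]
  by (simp add: I_iff diff02_def one_grp residue_pair_eq_iff dvd_diff_commute)

lemma is_CEDF_C:
  "is_CEDF (grp k) (3 * (2 * k + 1)\<^sup>2 + 1) 3 (2 * k + 1) 1 [C0 k, C1 k, C2 k]"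
proof -
  let ?G = "grp k" and ?Cs = "[C0 k, C1 k, C2 k]"
  interpret group ?G by (rule group_grp)
  have C: "C0 k = elt0 k ` I" "C1 k = elt1 k ` I" "C2 k = elt2 k ` I"
    by (simp_all add: C0_centred C1_centred C2_centred I_def)
  have sub: "C0 k \<subseteq> carrier ?G" "C1 k \<subseteq> carrier ?G" "C2 k \<subseteq> carrier ?G"
    using symmetric_C0 symmetric_C1 symmetric_C2 by (simp_all add: symmetric_in_def)
  have less3: "i < 3 \<longleftrightarrow> i = 0 \<or> i = 1 \<or> i = 2" for i :: nat by auto
  have diff: "(i = 0 \<and> (\<exists>a\<in>I. \<exists>c\<in>I. x = elt1 k a \<and> y = elt0 k c \<and> x \<otimes>\<^bsub>?G\<^esub> inv\<^bsub>?G\<^esub> y = diff10 k a c)) \<or>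
      (i = 1 \<and> (\<exists>a\<in>I. \<exists>b\<in>I. x = elt2 k b \<and> y = elt1 k a \<and> x \<otimes>\<^bsub>?G\<^esub> inv\<^bsub>?G\<^esub> y = diff21 k b a)) \<or>
      (i = 2 \<and> (\<exists>b\<in>I. \<exists>c\<in>I. x = elt0 k c \<and> y = elt2 k b \<and> x \<otimes>\<^bsub>?G\<^esub> inv\<^bsub>?G\<^esub> y = diff02 k c b))"
    if "i < 3" "x \<in> ?Cs ! ((i + 1) mod 3)" "y \<in> ?Cs ! i" for i x y
  proof -
    from \<open>i < 3\<close> consider "i = 0" | "i = 1" | "i = 2" by linarith
    then show ?thesis
    proof cases
      case 1 then show ?thesis using that(2,3) elt_differences(1) by (simp add: C) blast
    next
      case 2 then show ?thesis using that(2,3) elt_differences(2) by (simp add: C) blast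
    next
      case 3 then show ?thesis using that(2,3) elt_differences(3) by (simp add: C) blast
    qed
  qed
  have one: "x \<otimes>\<^bsub>?G\<^esub> inv\<^bsub>?G\<^esub> y \<noteq> \<one>\<^bsub>?G\<^esub>"
    if "i < 3" "x \<in> ?Cs ! ((i + 1) mod 3)" "y \<in> ?Cs ! i" for i x y
    using diff[OF that] by (elim disjE conjE bexE) (simp_all add: diff10_ne_one diff21_ne_one diff02_ne_one)
  \<comment> \<open>A common element would have the identity as a difference.\<close>
  have next_disj: "?Cs ! ((i + 1) mod 3) \<inter> ?Cs ! i = {}" if "i < 3" for i
  proof (rule ccontr)
    assume "?Cs ! ((i + 1) mod 3) \<inter> ?Cs ! i \<noteq> {}"
    then obtain z where z: "z \<in> ?Cs ! ((i + 1) mod 3)" "z \<in> ?Cs ! i" by blast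
    then have "z \<in> carrier ?G" using \<open>i < 3\<close> sub by (auto simp: less3)
    then show False using one[OF that z] by simp
  qed
  \<comment> \<open>For three sets, any two are cyclically consecutive.\<close>
  have disj: "C1 k \<inter> C0 k = {}" "C2 k \<inter> C1 k = {}" "C0 k \<inter> C2 k = {}"
    using next_disj[of 0] next_disj[of 1] next_disj[of 2] by simp_all
  have inj: "inj_on (\<lambda>(i, x, y). x \<otimes>\<^bsub>?G\<^esub> inv\<^bsub>?G\<^esub> y) (SIGMA i:{..<3}. ?Cs ! ((i + 1) mod 3) \<times> ?Cs ! i)"
  proof (rule inj_onI)
    fix p q
    assume p_in: "p \<in> (SIGMA i:{..<3}. ?Cs ! ((i + 1) mod 3) \<times> ?Cs ! i)"
      and q_in: "q \<in> (SIGMA i:{..<3}. ?Cs ! ((i + 1) mod 3) \<times> ?Cs ! i)"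
      and eq: "(case p of (i, x, y) \<Rightarrow> x \<otimes>\<^bsub>?G\<^esub> inv\<^bsub>?G\<^esub> y) = (case q of (i, x, y) \<Rightarrow> x \<otimes>\<^bsub>?G\<^esub> inv\<^bsub>?G\<^esub> y)"
    obtain i x y where p: "p = (i, x, y)" by (cases p) auto
    obtain i' x' y' where q: "q = (i', x', y')" by (cases q) auto
    have x: "i < 3" "x \<in> ?Cs ! ((i + 1) mod 3)" "y \<in> ?Cs ! i"
      using p_in unfolding p mem_Sigma_iff lessThan_iff by blast+
    have x': "i' < 3" "x' \<in> ?Cs ! ((i' + 1) mod 3)" "y' \<in> ?Cs ! i'"
      using q_in unfolding q mem_Sigma_iff lessThan_iff by blast+
    have xx': "x \<otimes>\<^bsub>?G\<^esub> inv\<^bsub>?G\<^esub> y = x' \<otimes>\<^bsub>?G\<^esub> inv\<^bsub>?G\<^esub> y'" using eq by (simp add: p q)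
    from diff[OF x] diff[OF x'] show "p = q"
      by (elim disjE conjE bexE) (use xx' in \<open>simp_all only: p q diff10_eq_iff diff21_eq_iff diff02_eq_iff
          diff10_ne_diff21 diff10_ne_diff02 diff21_ne_diff02 not_False_eq_True
          diff10_ne_diff21[symmetric] diff10_ne_diff02[symmetric] diff21_ne_diff02[symmetric]\<close>)
  qed
  have "is_CEDF ?G (order ?G) 3 (2 * k + 1) 1 ?Cs"
  proof (rule is_CEDF_if_differences_distinct[OF group_grp])
    show "card (?Cs ! i) = 2 * k + 1" if "i < 3" for i
      using that by (auto simp: less3 C0_centred C1_centred C2_centred card_image inj_elt0 inj_elt1 inj_elt2)
    show "?Cs ! i \<inter> ?Cs ! j = {}" if "i < 3" "j < 3" "i \<noteq> j" for i j
      using that disj by (auto simp: less3)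
    show "?Cs ! i \<subseteq> carrier ?G" if "i < 3" for i
      using that sub by (auto simp: less3)
    show "finite (carrier ?G)" by (simp add: carrier_grp)
    show "order ?G = 3 * (2 * k + 1)\<^sup>2 + 1" by (rule order_grp)
  qed (simp_all only: inj one, simp_all)
  then show ?thesis by (simp only: order_grp)
qed

end

theorem theorem4p6:
  fixes k :: nat
  shows "comm_group (grp k) \<and> \<not> cyclic_group (grp k) \<and>
    is_CEDF (grp k) (3 * (2 * k + 1)\<^sup>2 + 1) 3 (2 * k + 1) 1 [C0 k, C1 k, C2 k] \<and>
    symmetric_in (grp k) (C0 k) \<and> symmetric_in (grp k) (C1 k) \<and> symmetric_in (grp k) (C2 k)"
  using comm_group_grp not_cyclic_grp is_CEDF_C symmetric_C0 symmetric_C1 symmetric_C2 by blast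

end
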